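(* Let $1\le k<n$ and let $F$ be a real 2-uniform $(n,k)$-frame with associated graph $G_F$, and let $1\le m\le n$. Then $$e_m^{\infty}(F)\le \frac{k}{n}+(m-1)c_{n,k},\qquad c_{n,k}=\sqrt{\frac{k(n-k)}{n^2(n-1)}},$$ with equality if and only if $G_F$ contains an induced subgraph on $m$ vertices that is complete bipartite.
   Context: A real $(n,k)$-frame is a family $F=\{f_1,\dots,f_n\}$ of $n$ vectors in $\mathbb{R}^k$ that is Parseval: $\|x\|^2=\sum_j|\langle x,f_j\rangle|^2$ for all $x\in\mathbb{R}^k$. Its analysis operator is $V:\mathbb{R}^k\to\mathbb{R}^n$, $(Vx)_i=\langle x,f_i\rangle$. It is uniform if all $\|f_j\|$ are equal (then $\|f_j\|^2=k/n$). Let $\mathcal{D}_m$ be the set of $n\times n$ diagonal matrices with exactly $m$ diagonal entries equal to $1$ and $n-m$ equal to $0$. $F$ is 2-uniform if it is uniform and $\|V^*DV\|$ is the same for all $D\in\mathcal{D}_2$. Norms of matrices are operator norms. Define $e_m^\infty(F)=\max\{\|V^*DV\|:D\in\mathcal{D}_m\}$. For a real 2-uniform $(n,k)$-frame, $|\langle f_j,f_i\rangle|=c_{n,k}$ for all $i\ne j$, and one writes $VV^*=\frac{k}{n}I_n+c_{n,k}Q$, where $Q$ (the signature matrix of $F$) is symmetric with zero diagonal and off-diagonal entries $\pm1$. The graph $G_F$ has vertex set $\{1,\dots,n\}$ and distinct $i,j$ are adjacent iff $q_{i,j}=-1$; that is, $Q$ is the Seidel adjacency matrix of $G_F$ (entry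 $-1$ if adjacent, $+1$ if non-adjacent, $0$ on the diagonal). A graph on $m$ vertices is called complete bipartite if its vertex set is a disjoint union $V_1\cup V_2$, where one of $V_1,V_2$ may be empty, such that no two vertices within $V_1$ or within $V_2$ are adjacent and every vertex of $V_1$ is adjacent to every vertex of $V_2$. In particular the edgeless graph counts as complete bipartite. *)

theory Defs
  imports "HOL-Analysis.Analysis" "Graph_Theory.Graph_Theory"
begin

text \<open>
  A real \<open>(n,k)\<close>-frame is a family \<open>F :: 'n \<Rightarrow> real ^ 'k\<close> with
  \<open>n = CARD('n)\<close> and \<open>k = CARD('k)\<close>; the index type \<open>'n\<close> plays the role of
  \<open>{1,\<dots>,n}\<close>.
\<close>

definition frame :: "('n::finite \<Rightarrow> real ^ 'k) \<Rightarrow> bool" where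
  "frame F \<longleftrightarrow> (\<forall>x. (norm x)\<^sup>2 = (\<Sum>j\<in>UNIV. \<bar>x \<bullet> F j\<bar>\<^sup>2))"

definition analysis_operator :: "('n::finite \<Rightarrow> real ^ 'k) \<Rightarrow> real ^ 'k \<Rightarrow> real ^ 'n" where
  "analysis_operator F x = (\<chi> i. x \<bullet> F i)"

definition analysis_matrix :: "('n::finite \<Rightarrow> real ^ 'k) \<Rightarrow> real ^ 'k ^ 'n" where
  "analysis_matrix F = matrix (analysis_operator F)"

definition diag01 :: "nat \<Rightarrow> (real ^ 'n ^ 'n) set" where
  "diag01 m = {D. (\<forall>i j. i \<noteq> j \<longrightarrow> D $ i $ j = 0) \<and> (\<forall>i. D $ i $ i = 0 \<or> D $ i $ i = 1) \<and>
                  card {i. D $ i $ i = 1} = m}"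

text \<open>
  Matrices are normed by \<^const>\<open>onorm\<close>, the operator norm with respect to the Euclidean norms;
  \<^const>\<open>norm\<close> on the matrix type would be the Frobenius norm.
\<close>

definition erasure_error :: "('n::finite \<Rightarrow> real ^ 'k) \<Rightarrow> real ^ 'n ^ 'n \<Rightarrow> real" where
  "erasure_error F D = onorm ((*v) (transpose (analysis_matrix F) ** D ** analysis_matrix F))"

definition max_erasure_error :: "nat \<Rightarrow> ('n::finite \<Rightarrow> real ^ 'k) \<Rightarrow> real" where
  "max_erasure_error m F = Max (erasure_error F ` diag01 m)"

definition uniform_frame :: "('n::finite \<Rightarrow> real ^ 'k) \<Rightarrow> bool" where
  "uniform_frame F \<longleftrightarrow> frame F \<and> (\<forall>i j. norm (F i) = norm (F j))"

definition two_uniform_frame :: "('n::finite \<Rightarrow> real ^ 'k) \<Rightarrow> bool" where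
  "two_uniform_frame F \<longleftrightarrow> uniform_frame F \<and>
     (\<forall>D\<in>diag01 2. \<forall>D'\<in>diag01 2. erasure_error F D = erasure_error F D')"

definition frame_const :: "nat \<Rightarrow> nat \<Rightarrow> real" where
  "frame_const n k = sqrt (real k * (real n - real k) / ((real n)\<^sup>2 * (real n - 1)))"

text \<open>The matrix \<open>Q\<close> obtained by solving \<open>V V\<^sup>* = (k/n) I + c Q\<close>, where \<open>c = frame_const n k\<close>.\<close>

definition signature_matrix :: "('n::finite \<Rightarrow> real ^ 'k) \<Rightarrow> real ^ 'n ^ 'n" where
  "signature_matrix F = (1 / frame_const CARD('n) CARD('k)) *\<^sub>R
     (analysis_matrix F ** transpose (analysis_matrix F) - mat (real CARD('k) / real CARD('n)))"

text \<open>Simple graphs are symmetric digraphs without loops and multiple arcs, as in \<^locale>\<open>graph\<close>.\<close>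

definition frame_graph :: "('n::finite \<Rightarrow> real ^ 'k) \<Rightarrow> ('n, 'n \<times> 'n) pre_digraph" where
  "frame_graph F = \<lparr>verts = UNIV, arcs = {(i, j). i \<noteq> j \<and> signature_matrix F $ i $ j = -1},
                    tail = fst, head = snd\<rparr>"

text \<open>
  \<^const>\<open>complete_bipartite_digraph\<close> allows empty parts, so edgeless graphs are complete bipartite.
\<close>

definition complete_bipartite :: "('a, 'b) pre_digraph \<Rightarrow> bool" where
  "complete_bipartite G \<longleftrightarrow> (\<exists>p q. complete_bipartite_digraph p q G)"

lemma analysis_matrix_nth [simp]: "analysis_matrix F $ i $ j = F i $ j"
  by (simp add: analysis_matrix_def analysis_operator_def matrix_def inner_axis inner_commute)

lemma analysis_matrix_mult [simp]: "analysis_matrix F *v x = analysis_operator F x"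
  by (simp add: matrix_vector_mult_def analysis_operator_def inner_vec_def vec_eq_iff mult.commute)

lemma diag01_finite_nonempty:
  assumes "m \<le> CARD('n::finite)"
  shows "finite (diag01 m :: (real ^ 'n ^ 'n) set)" "(diag01 m :: (real ^ 'n ^ 'n) set) \<noteq> {}"
proof -
  let ?d = "\<lambda>S::'n set. (\<chi> i j. if i = j \<and> i \<in> S then 1 else 0) :: real ^ 'n ^ 'n"
  have "D \<in> range ?d" if "D \<in> diag01 m" for D
  proof
    show "D = ?d {i. D $ i $ i = 1}"
      using that unfolding diag01_def vec_eq_iff by (simp; metis)
  qed auto
  then have "diag01 m \<subseteq> range ?d" by blast
  then show "finite (diag01 m :: (real ^ 'n ^ 'n) set)" by (rule finite_subset) simp
  obtain S :: "'n set" where "card S = m"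
    using obtain_subset_with_card_n[OF assms] by blast
  then have "?d S \<in> diag01 m" by (simp add: diag01_def)
  then show "(diag01 m :: (real ^ 'n ^ 'n) set) \<noteq> {}" by blast
qed

lemma signature_matrix_eq:
  fixes F :: "'n::finite \<Rightarrow> real ^ 'k"
  assumes "CARD('k) < CARD('n)"
  shows "analysis_matrix F ** transpose (analysis_matrix F) =
    mat (real CARD('k) / real CARD('n)) + frame_const CARD('n) CARD('k) *\<^sub>R signature_matrix F"
proof -
  have "0 < CARD('k)" by simp
  moreover from this have "CARD('n) \<noteq> 1" using assms by linarith
  ultimately have "frame_const CARD('n) CARD('k) \<noteq> 0"
    using assms by (simp add: frame_const_def)
  then show ?thesis by (simp add: signature_matrix_def)
qed

lemma graph_frame_graph: "graph (frame_graph F)"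
proof -
  have "signature_matrix F $ i $ j = signature_matrix F $ j $ i" for i j
    by (simp add: signature_matrix_def matrix_matrix_mult_def transpose_def mat_def mult.commute)
  then show ?thesis
    by unfold_locales
      (auto simp: frame_graph_def arc_to_ends_def arcs_ends_def symmetric_def intro!: symI)
qed

end

theory Submission
  imports Defs
begin

text \<open>
  For a set \<open>S\<close> of \<open>m\<close> indices, \<open>T x = (\<Sum>j\<in>S. (x \<bullet> f\<^sub>j) f\<^sub>j)\<close> is the operator \<open>V\<^sup>*DV\<close>. With
  \<open>y\<^sub>j = x \<bullet> f\<^sub>j\<close> and \<open>f\<^sub>i \<bullet> f\<^sub>j = c s\<^sub>i\<^sub>j\<close>, \<open>s\<^sub>i\<^sub>j = \<plusminus>1\<close>, for \<open>i \<noteq> j\<close>, one has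
  \<open>(a + (m - 1) c) \<bar>y\<bar>\<^sup>2 - \<bar>T x\<bar>\<^sup>2 = (c / 2) (\<Sum>i\<noteq>j. (y\<^sub>i - s\<^sub>i\<^sub>j y\<^sub>j)\<^sup>2)\<close> where \<open>a = \<bar>f\<^sub>j\<bar>\<^sup>2\<close>, while
  \<open>\<bar>y\<bar>\<^sup>2 = x \<bullet> T x \<le> \<bar>x\<bar> \<bar>T x\<bar>\<close>. Hence \<open>\<bar>T\<bar> \<le> a + (m - 1) c\<close>, and equality forces
  \<open>y\<^sub>i = s\<^sub>i\<^sub>j y\<^sub>j\<close>: the signs of the \<open>y\<^sub>j\<close> split \<open>S\<close> into the two sides of a complete bipartite graph.
  For \<open>m = 2\<close> equality always holds, which turns 2-uniformity into equiangularity.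
\<close>

section \<open>Partial frame operators and operator norms\<close>

definition partial_frame_operator :: "('i \<Rightarrow> 'a::real_inner) \<Rightarrow> 'i set \<Rightarrow> 'a \<Rightarrow> 'a" where
  "partial_frame_operator F S x = (\<Sum>j\<in>S. (x \<bullet> F j) *\<^sub>R F j)"

lemma bounded_linear_partial_frame_operator: "bounded_linear (partial_frame_operator F S)"
  unfolding partial_frame_operator_def [abs_def]
  by (intro bounded_linear_sum bounded_linear_scaleR_const bounded_linear_inner_left)

lemma inner_partial_frame_operator:
  "x \<bullet> partial_frame_operator F S x = (\<Sum>j\<in>S. (x \<bullet> F j)\<^sup>2)"
  by (simp add: partial_frame_operator_def inner_sum_right power2_eq_square)

lemma norm_partial_frame_operator_power2:
  "(norm (partial_frame_operator F S x))\<^sup>2 =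
     (\<Sum>i\<in>S. \<Sum>j\<in>S. (x \<bullet> F i) * (x \<bullet> F j) * (F i \<bullet> F j))"
  by (simp add: partial_frame_operator_def power2_norm_eq_inner inner_sum_left inner_sum_right
      sum_distrib_left mult.assoc) (simp add: inner_commute)

text \<open>The unit sphere of a Euclidean space is compact and nonempty, so the supremum defining
  the operator norm is a maximum. The equality case is read off from a maximizing vector.\<close>

lemma onorm_attained:
  fixes f :: "'a::euclidean_space \<Rightarrow> 'b::real_normed_vector"
  assumes "bounded_linear f"
  obtains x where "norm x = 1" "norm (f x) = onorm f"
proof -
  interpret f: bounded_linear f by fact
  obtain b :: 'a where "b \<in> Basis" using nonempty_Basis by blast
  then have "sphere (0::'a) 1 \<noteq> {}" by (auto intro!: exI[of _ b])
  moreover have "continuous_on (sphere 0 1) (\<lambda>x. norm (f x))"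
    by (intro continuous_intros f.continuous_on)
  ultimately obtain x :: 'a where x: "x \<in> sphere 0 1"
    and max: "\<And>y. y \<in> sphere 0 1 \<Longrightarrow> norm (f y) \<le> norm (f x)"
    using continuous_attains_sup[OF compact_sphere] by blast
  have "norm (f y) \<le> norm (f x) * norm y" for y
  proof (cases "y = 0")
    case False
    then have "norm (f (y /\<^sub>R norm y)) \<le> norm (f x)"
      by (intro max) simp
    then show ?thesis
      using False by (simp add: f.scaleR field_simps)
  qed (simp add: f.zero)
  then have "onorm f \<le> norm (f x)" by (rule onorm_bound[rotated]) simp
  moreover have "norm (f x) \<le> onorm f" using onorm[OF assms, of x] x by simp
  ultimately show thesis using x by (intro that[of x]) auto
qed

lemma le_onorm_eigenvalue:
  assumes "bounded_linear f" "f z = b *\<^sub>R z" "z \<noteq> 0"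
  shows "\<bar>b\<bar> \<le> onorm f"
  using le_onorm[OF assms(1), of z] assms by simp

section \<open>Norms of partial frame operators of equiangular families\<close>

locale equiangular =
  fixes F :: "'i \<Rightarrow> 'a::euclidean_space" and S :: "'i set" and a c :: real
    and s :: "'i \<Rightarrow> 'i \<Rightarrow> real"
  assumes finite: "finite S" and nonempty: "S \<noteq> {}" and a_pos: "0 < a" and c_nonneg: "0 \<le> c"
    and inner_same: "\<And>i. i \<in> S \<Longrightarrow> F i \<bullet> F i = a"
    and inner_distinct: "\<And>i j. i \<in> S \<Longrightarrow> j \<in> S \<Longrightarrow> i \<noteq> j \<Longrightarrow> F i \<bullet> F j = c * s i j"
    and sign: "\<And>i j. i \<in> S \<Longrightarrow> j \<in> S \<Longrightarrow> i \<noteq> j \<Longrightarrow> s i j \<in> {1, -1}"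
begin

abbreviation "T \<equiv> partial_frame_operator F S"

definition "bound = a + (real (card S) - 1) * c"

lemma card_ge_1: "1 \<le> real (card S)"
  using finite nonempty by (simp add: Suc_le_eq card_gt_0_iff)

lemma bound_pos: "0 < bound"
  using a_pos c_nonneg card_ge_1 unfolding bound_def by (intro add_pos_nonneg mult_nonneg_nonneg) auto

text \<open>Since \<open>s i j\<close> squares to 1, expanding the squares over ordered pairs yields
  a multiple of the sum of the \<open>(y i)\<^sup>2\<close> and minus twice the cross terms of the
  Gram form. Solving for the cross terms exhibits the Gram form as its bound minus a nonnegative
  deficit.\<close>

lemma gram_form:
  "(\<Sum>i\<in>S. \<Sum>j\<in>S. y i * y j * (F i \<bullet> F j)) =
     bound * (\<Sum>i\<in>S. (y i)\<^sup>2) - c / 2 * (\<Sum>i\<in>S. \<Sum>j\<in>S - {i}. (y i - s i j * y j)\<^sup>2)"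
proof -
  let ?Y = "\<Sum>i\<in>S. (y i)\<^sup>2"
  let ?P = "\<Sum>i\<in>S. \<Sum>j\<in>S - {i}. s i j * (y i * y j)"
  have "(\<Sum>j\<in>S. y i * y j * (F i \<bullet> F j)) = a * (y i)\<^sup>2 + c * (\<Sum>j\<in>S - {i}. s i j * (y i * y j))"
    if "i \<in> S" for i
  proof -
    have "F i \<bullet> F j = c * s i j" if "j \<in> S - {i}" for j
      using inner_distinct[OF \<open>i \<in> S\<close>, of j] that by auto
    then have "(\<Sum>j\<in>S - {i}. y i * y j * (F i \<bullet> F j)) = c * (\<Sum>j\<in>S - {i}. s i j * (y i * y j))"
      by (simp add: sum_distrib_left ac_simps)
    then show ?thesis
      using that by (simp add: sum.remove[OF finite that] inner_same power2_eq_square)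
  qed
  then have gram: "(\<Sum>i\<in>S. \<Sum>j\<in>S. y i * y j * (F i \<bullet> F j)) = a * ?Y + c * ?P"
    by (simp add: sum.distrib sum_distrib_left)
  \<comment> \<open>The coefficient \<open>card S - 2\<close> combines \<open>card S - 1\<close>
    copies of \<open>(y i)\<^sup>2\<close> with the one missing from the sum of
    \<open>(y j)\<^sup>2\<close> over \<open>S - {i}\<close>.\<close>
  have "(\<Sum>j\<in>S - {i}. (y i - s i j * y j)\<^sup>2) =
      (real (card S) - 2) * (y i)\<^sup>2 + ?Y - 2 * (\<Sum>j\<in>S - {i}. s i j * (y i * y j))"
    if "i \<in> S" for i
  proof -
    have "(s i j)\<^sup>2 = 1" if "j \<in> S - {i}" for j
      using sign[OF \<open>i \<in> S\<close>, of j] that by auto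
    then have "(\<Sum>j\<in>S - {i}. (y i - s i j * y j)\<^sup>2) =
        (\<Sum>j\<in>S - {i}. (y i)\<^sup>2 + (y j)\<^sup>2 - 2 * (s i j * (y i * y j)))"
      by (intro sum.cong) (auto simp: power2_diff power_mult_distrib)
    also have "\<dots> = real (card (S - {i})) * (y i)\<^sup>2 + (\<Sum>j\<in>S - {i}. (y j)\<^sup>2)
        - 2 * (\<Sum>j\<in>S - {i}. s i j * (y i * y j))"
      by (simp add: sum.distrib sum_subtractf sum_distrib_left)
    also have "real (card (S - {i})) = real (card S) - 1"
      using that finite card_ge_1 by (simp add: of_nat_diff)
    also have "(\<Sum>j\<in>S - {i}. (y j)\<^sup>2) = ?Y - (y i)\<^sup>2"
      using that finite by (simp add: sum_diff1)
    finally show ?thesis by (simp add: algebra_simps)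
  qed
  then have "(\<Sum>i\<in>S. \<Sum>j\<in>S - {i}. (y i - s i j * y j)\<^sup>2) =
      (\<Sum>i\<in>S. (real (card S) - 2) * (y i)\<^sup>2 + ?Y - 2 * (\<Sum>j\<in>S - {i}. s i j * (y i * y j)))"
    by (rule sum.cong[OF refl])
  also have "\<dots> = (real (card S) - 2) * ?Y + real (card S) * ?Y - 2 * ?P"
    by (simp add: sum.distrib sum_subtractf sum_distrib_left)
  finally have "(\<Sum>i\<in>S. \<Sum>j\<in>S - {i}. (y i - s i j * y j)\<^sup>2) =
      2 * (real (card S) - 1) * ?Y - 2 * ?P"
    by (simp add: algebra_simps)
  then show ?thesis
    unfolding gram bound_def by (simp only:) (simp add: algebra_simps)
qed

lemma norm_power2:
  "(norm (T x))\<^sup>2 = bound * (x \<bullet> T x)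
     - c / 2 * (\<Sum>i\<in>S. \<Sum>j\<in>S - {i}. (x \<bullet> F i - s i j * (x \<bullet> F j))\<^sup>2)"
  unfolding norm_partial_frame_operator_power2 inner_partial_frame_operator by (rule gram_form)

lemma deficit_nonneg: "0 \<le> c / 2 * (\<Sum>i\<in>S. \<Sum>j\<in>S - {i}. (x \<bullet> F i - s i j * (x \<bullet> F j))\<^sup>2)"
  using c_nonneg by (intro mult_nonneg_nonneg sum_nonneg) auto

lemma onorm_le_bound: "onorm T \<le> bound"
proof (rule onorm_bound)
  fix x
  have "(norm (T x))\<^sup>2 \<le> bound * (x \<bullet> T x)"
    using norm_power2[of x] deficit_nonneg[of x] by simp
  also have "\<dots> \<le> bound * (norm x * norm (T x))"
    using bound_pos by (intro mult_left_mono norm_cauchy_schwarz) auto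
  finally have "norm (T x) * norm (T x) \<le> (bound * norm x) * norm (T x)"
    by (simp add: power2_eq_square mult.assoc)
  then show "norm (T x) \<le> bound * norm x"
    using bound_pos by (cases "T x = 0") auto
qed (use bound_pos in simp)

lemma onorm_eq_boundD:
  assumes "onorm T = bound" "0 < c"
  obtains e where "\<And>i. i \<in> S \<Longrightarrow> e i \<in> {1, -1::real}"
    "\<And>i j. i \<in> S \<Longrightarrow> j \<in> S \<Longrightarrow> i \<noteq> j \<Longrightarrow> s i j = e i * e j"
proof -
  obtain x where x: "norm x = 1" "norm (T x) = bound"
    using onorm_attained[OF bounded_linear_partial_frame_operator] assms(1) by metis
  let ?y = "\<lambda>j. x \<bullet> F j"
  \<comment> \<open>At the maximizer, \<open>(norm (T x))\<^sup>2\<close> equals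
    \<open>bound * bound\<close>, which is also an upper bound for
    \<open>bound * (x \<bullet> T x)\<close>. This squeezes the deficit to zero.\<close>
  have "x \<bullet> T x \<le> bound" using norm_cauchy_schwarz[of x "T x"] x by simp
  then have "bound * (x \<bullet> T x) \<le> bound * bound" using bound_pos by simp
  then have "c / 2 * (\<Sum>i\<in>S. \<Sum>j\<in>S - {i}. (?y i - s i j * ?y j)\<^sup>2) = 0"
    using norm_power2[of x] deficit_nonneg[of x] x(2) by (simp add: power2_eq_square)
  then have "(\<Sum>i\<in>S. \<Sum>j\<in>S - {i}. (?y i - s i j * ?y j)\<^sup>2) = 0"
    using assms(2) by simp
  then have "\<forall>i\<in>S. \<forall>j\<in>S - {i}. (?y i - s i j * ?y j)\<^sup>2 = 0"
    using finite by (simp add: sum_nonneg_eq_0_iff sum_nonneg)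
  then have eq: "?y i = s i j * ?y j" if "i \<in> S" "j \<in> S" "i \<noteq> j" for i j
    using that(1) bspec[of "S - {i}" _ j] that(2,3) by fastforce
  \<comment> \<open>The relations propagate a single vanishing coefficient to all of
    \<open>S\<close>, which would give \<open>T x = 0\<close>. The signs of the coefficients are
    therefore well defined.\<close>
  have nonzero: "?y j \<noteq> 0" if "j \<in> S" for j
  proof
    assume "?y j = 0"
    then have "?y i = 0" if "i \<in> S" for i using eq[OF that \<open>j \<in> S\<close>] by (cases "i = j") auto
    then have "T x = 0" by (simp add: partial_frame_operator_def)
    then show False using x(2) bound_pos by simp
  qed
  have "s i j = sgn (?y i) * sgn (?y j)" if "i \<in> S" "j \<in> S" "i \<noteq> j" for i j
    using sign[OF that] eq[OF that] nonzero[OF that(1)] nonzero[OF that(2)]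
    by (auto simp: sgn_minus sgn_if)
  then show thesis
    using nonzero by (intro that[of "\<lambda>j. sgn (?y j)"]) (auto simp: sgn_if)
qed

text \<open>Replacing each \<open>F j\<close> by \<open>e j *\<^sub>R F j\<close> turns all mutual
  inner products into \<open>c\<close>. The sum \<open>z\<close> of the modified vectors is then an
  eigenvector of \<open>T\<close> with eigenvalue \<open>bound\<close>.\<close>

lemma onorm_eq_boundI:
  assumes e: "\<And>i. i \<in> S \<Longrightarrow> e i \<in> {1, -1::real}"
    and s: "\<And>i j. i \<in> S \<Longrightarrow> j \<in> S \<Longrightarrow> i \<noteq> j \<Longrightarrow> s i j = e i * e j"
  shows "onorm T = bound"
proof -
  define z where "z = (\<Sum>j\<in>S. e j *\<^sub>R F j)"
  have inner_z: "z \<bullet> F i = bound * e i" if "i \<in> S" for i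
  proof -
    have "(\<Sum>j\<in>S - {i}. e j * (F j \<bullet> F i)) = (\<Sum>j\<in>S - {i}. c * e i)"
    proof (intro sum.cong refl)
      fix j assume j: "j \<in> S - {i}"
      then show "e j * (F j \<bullet> F i) = c * e i"
        using that e[of j] by (auto simp: inner_distinct s)
    qed
    also have "\<dots> = (real (card S) - 1) * c * e i"
      using that finite card_ge_1 by (simp add: of_nat_diff)
    finally show ?thesis
      using that by (simp add: z_def inner_sum_left sum.remove[OF finite that] inner_same bound_def
          algebra_simps)
  qed
  have "T z = bound *\<^sub>R z"
    by (simp add: partial_frame_operator_def inner_z) (simp add: z_def scaleR_sum_right)
  moreover have "z \<noteq> 0"
  proof
    assume "z = 0"
    obtain i where "i \<in> S" using nonempty by blast
    then show False using inner_z[of i] e[of i] \<open>z = 0\<close> bound_pos by auto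
  qed
  ultimately have "\<bar>bound\<bar> \<le> onorm T"
    by (rule le_onorm_eigenvalue[OF bounded_linear_partial_frame_operator])
  then show ?thesis using onorm_le_bound by simp
qed

end

text \<open>A pair carries only one sign, which always factors, so the bound is attained. Here
  \<open>c\<close> is the modulus of the inner product and may be 0, which is why the locale assumes
  only \<open>0 \<le> c\<close>.\<close>

lemma onorm_partial_frame_operator_pair:
  fixes F :: "'i \<Rightarrow> 'a::euclidean_space"
  assumes "i \<noteq> j" "F i \<bullet> F i = a" "F j \<bullet> F j = a" "0 < a"
  shows "onorm (partial_frame_operator F {i, j}) = a + \<bar>F i \<bullet> F j\<bar>"
proof -
  \<comment> \<open>Unlike \<open>sgn\<close>, this sign is 1 for orthogonal vectors, as values in
    \<open>{1, -1}\<close> are required.\<close>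
  define t :: real where "t = (if F i \<bullet> F j < 0 then -1 else 1)"
  interpret equiangular F "{i, j}" a "\<bar>F i \<bullet> F j\<bar>" "\<lambda>_ _. t"
    using assms by unfold_locales (auto simp: t_def inner_commute)
  have "onorm T = bound"
    by (rule onorm_eq_boundI[of "\<lambda>l. if l = i then 1 else t"]) (auto simp: t_def)
  then show ?thesis using assms(1) by (simp add: bound_def)
qed

section \<open>Erasure errors as norms of partial frame operators\<close>

lemma analysis_gram: "(analysis_matrix F ** transpose (analysis_matrix F)) $ i $ j = F i \<bullet> F j"
  by (simp add: matrix_matrix_mult_def transpose_def inner_vec_def)

lemma erasure_error_eq_onorm:
  assumes "D \<in> diag01 m"
  shows "erasure_error F D = onorm (partial_frame_operator F {i. D $ i $ i = 1})"
proof -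
  have "D *v y = (\<chi> i. if D $ i $ i = 1 then y $ i else 0)" for y
  proof -
    have "(\<Sum>j\<in>UNIV. D $ i $ j * y $ j) = (\<Sum>j\<in>UNIV. if j = i then D $ i $ i * y $ i else 0)" for i
      using assms by (intro sum.cong) (auto simp: diag01_def)
    then show ?thesis
      using assms by (auto simp: vec_eq_iff matrix_vector_mult_def diag01_def)
  qed
  then have "(transpose (analysis_matrix F) ** D ** analysis_matrix F) *v x =
      transpose (analysis_matrix F) *v (\<chi> i. if D $ i $ i = 1 then x \<bullet> F i else 0)" for x
    unfolding matrix_vector_mul_assoc[symmetric] by (simp add: analysis_operator_def cong: if_cong)
  also have "transpose (analysis_matrix F) *v (\<chi> i. if D $ i $ i = 1 then x \<bullet> F i else 0) =
      partial_frame_operator F {i. D $ i $ i = 1} x" for x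
    unfolding vec_eq_iff matrix_vector_mult_def transpose_def partial_frame_operator_def
    by (simp add: if_distrib sum.If_cases mult.commute cong: if_cong)
  finally have "(*v) (transpose (analysis_matrix F) ** D ** analysis_matrix F) =
      partial_frame_operator F {i. D $ i $ i = 1}" by (rule ext)
  then show ?thesis by (simp only: erasure_error_def)
qed

text \<open>Sending a matrix in \<open>diag01 m\<close> to the positions of its ones hits every
  index set of size \<open>m\<close>, so the maximum can be taken over such sets.\<close>

lemma erasure_error_image:
  fixes F :: "'n::finite \<Rightarrow> real ^ 'k"
  shows "erasure_error F ` diag01 m = (\<lambda>S. onorm (partial_frame_operator F S)) ` {S. card S = m}"
proof -
  have "(\<lambda>D. {i. D $ i $ i = 1}) ` (diag01 m :: (real ^ 'n ^ 'n) set) = {S. card S = m}"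
  proof (intro equalityI subsetI)
    fix S :: "'n set" assume "S \<in> {S. card S = m}"
    then show "S \<in> (\<lambda>D. {i. D $ i $ i = 1}) ` (diag01 m :: (real ^ 'n ^ 'n) set)"
      by (intro image_eqI[of _ _ "\<chi> i j. if i = j \<and> i \<in> S then 1 else 0"]) (auto simp: diag01_def)
  qed (auto simp: diag01_def)
  moreover have "erasure_error F ` diag01 m =
      (\<lambda>S. onorm (partial_frame_operator F S)) ` (\<lambda>D. {i. D $ i $ i = 1}) ` diag01 m"
    unfolding image_image by (intro image_cong refl erasure_error_eq_onorm)
  ultimately show ?thesis by simp
qed

section \<open>Inner products in uniform and 2-uniform frames\<close>

lemma frame_sum_norm_power2:
  fixes F :: "'n::finite \<Rightarrow> real ^ 'k"
  assumes "frame F"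
  shows "(\<Sum>j\<in>UNIV. (norm (F j))\<^sup>2) = real CARD('k)"
proof -
  have "(\<Sum>j\<in>UNIV. (norm (F j))\<^sup>2) = (\<Sum>j\<in>UNIV. \<Sum>b\<in>Basis. (b \<bullet> F j)\<^sup>2)"
    unfolding power2_norm_eq_inner
    by (subst euclidean_inner) (simp add: inner_commute power2_eq_square)
  \<comment> \<open>After the swap, Parseval applies to each of the k basis vectors. In effect the
    trace of \<open>V\<^sup>*V = I\<close> is computed.\<close>
  also have "\<dots> = (\<Sum>b\<in>(Basis :: (real ^ 'k) set). \<Sum>j\<in>UNIV. (b \<bullet> F j)\<^sup>2)"
    by (rule sum.swap)
  also have "\<dots> = (\<Sum>b\<in>(Basis :: (real ^ 'k) set). (norm b)\<^sup>2)"
  proof (rule sum.cong[OF refl])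
    show "(\<Sum>j\<in>UNIV. (b \<bullet> F j)\<^sup>2) = (norm b)\<^sup>2" for b
      using assms by (simp add: frame_def)
  qed
  finally show ?thesis by simp
qed

lemma uniform_frame_inner_same:
  fixes F :: "'n::finite \<Rightarrow> real ^ 'k"
  assumes "uniform_frame F"
  shows "F i \<bullet> F i = real CARD('k) / real CARD('n)"
proof -
  have "(\<Sum>j\<in>UNIV. (norm (F j))\<^sup>2) = (\<Sum>j\<in>(UNIV::'n set). (norm (F i))\<^sup>2)"
    using assms unfolding uniform_frame_def by (intro sum.cong) metis+
  moreover have "(\<Sum>j\<in>UNIV. (norm (F j))\<^sup>2) = real CARD('k)"
    using assms by (simp add: uniform_frame_def frame_sum_norm_power2)
  ultimately show ?thesis by (simp add: power2_norm_eq_inner field_simps)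
qed

lemma two_uniform_frame_equiangular:
  fixes F :: "'n::finite \<Rightarrow> real ^ 'k"
  assumes "two_uniform_frame F" "i \<noteq> j" "i' \<noteq> j'"
  shows "\<bar>F i \<bullet> F j\<bar> = \<bar>F i' \<bullet> F j'\<bar>"
proof -
  have "onorm (partial_frame_operator F {i, j}) \<in> erasure_error F ` diag01 2"
    "onorm (partial_frame_operator F {i', j'}) \<in> erasure_error F ` diag01 2"
    unfolding erasure_error_image using assms(2,3) by auto
  then have "onorm (partial_frame_operator F {i, j}) = onorm (partial_frame_operator F {i', j'})"
    using assms(1) unfolding two_uniform_frame_def by (metis imageE)
  moreover have "F l \<bullet> F l = real CARD('k) / real CARD('n)" for l
    using assms(1) by (simp add: two_uniform_frame_def uniform_frame_inner_same)
  ultimately show ?thesis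
    using assms(2,3) by (simp add: onorm_partial_frame_operator_pair)
qed

text \<open>Parseval at the vector \<open>F i\<close> itself, with equiangularity, reads a = a^2 +
  (n - 1) d^2 for a = k/n and d the common modulus. Solving for d gives the constant.\<close>

lemma two_uniform_frame_inner_distinct:
  fixes F :: "'n::finite \<Rightarrow> real ^ 'k"
  assumes "two_uniform_frame F" "i \<noteq> j"
  shows "\<bar>F i \<bullet> F j\<bar> = frame_const CARD('n) CARD('k)"
proof -
  let ?n = "real CARD('n)" and ?k = "real CARD('k)"
  have "card {i, j} \<le> CARD('n)" by (rule card_mono) auto
  then have n: "2 \<le> ?n" using assms(2) by simp
  have same: "F i \<bullet> F i = ?k / ?n"
    using assms(1) by (simp add: two_uniform_frame_def uniform_frame_inner_same)
  have "F i \<bullet> F i = (\<Sum>l\<in>UNIV. (F i \<bullet> F l)\<^sup>2)"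
    using assms(1) by (simp add: two_uniform_frame_def uniform_frame_def frame_def
        power2_norm_eq_inner[symmetric])
  also have "\<dots> = (F i \<bullet> F i)\<^sup>2 + (\<Sum>l\<in>UNIV - {i}. (F i \<bullet> F l)\<^sup>2)"
    by (rule sum.remove) auto
  also have "(\<Sum>l\<in>UNIV - {i}. (F i \<bullet> F l)\<^sup>2) = (\<Sum>l\<in>UNIV - {i}. (F i \<bullet> F j)\<^sup>2)"
  proof (intro sum.cong refl)
    fix l assume "l \<in> UNIV - {i}"
    then have "\<bar>F i \<bullet> F l\<bar> = \<bar>F i \<bullet> F j\<bar>"
      using assms by (intro two_uniform_frame_equiangular) auto
    then show "(F i \<bullet> F l)\<^sup>2 = (F i \<bullet> F j)\<^sup>2" by (simp add: power2_eq_iff abs_eq_iff)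
  qed
  also have "\<dots> = (?n - 1) * (F i \<bullet> F j)\<^sup>2"
    using n by (simp add: card_Diff_singleton of_nat_diff)
  finally have "(F i \<bullet> F j)\<^sup>2 = ?k * (?n - ?k) / (?n\<^sup>2 * (?n - 1))"
    using n unfolding same by (simp add: field_simps power2_eq_square)
  then show ?thesis
    unfolding frame_const_def by (metis real_sqrt_abs)
qed

text \<open>Strict positivity permits the division in \<open>signature_matrix\<close> and, in the
  equality case, lets a zero deficit force every square to vanish.\<close>

lemma frame_const_pos:
  assumes "0 < k" "k < n"
  shows "0 < frame_const n k"
proof -
  have "1 < n" using assms by linarith
  then show ?thesis
    using assms by (simp add: frame_const_def)
qed

section \<open>The signature matrix and induced subgraphs of the frame graph\<close>

lemma signature_matrix_distinct:
  fixes F :: "'n::finite \<Rightarrow> real ^ 'k"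
  assumes "i \<noteq> j"
  shows "signature_matrix F $ i $ j = (F i \<bullet> F j) / frame_const CARD('n) CARD('k)"
  using assms by (simp add: signature_matrix_def analysis_gram mat_def)

lemma two_uniform_frame_signature:
  fixes F :: "'n::finite \<Rightarrow> real ^ 'k"
  assumes "CARD('k) < CARD('n)" "two_uniform_frame F" "i \<noteq> j"
  shows "signature_matrix F $ i $ j \<in> {1, -1}"
    and "F i \<bullet> F j = frame_const CARD('n) CARD('k) * signature_matrix F $ i $ j"
proof -
  have c: "0 < frame_const CARD('n) CARD('k)"
    using assms(1) by (intro frame_const_pos) auto
  show "F i \<bullet> F j = frame_const CARD('n) CARD('k) * signature_matrix F $ i $ j"
    using c by (simp add: signature_matrix_distinct[OF assms(3)])
  show "signature_matrix F $ i $ j \<in> {1, -1}"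
    using c two_uniform_frame_inner_distinct[OF assms(2,3)]
    by (auto simp: signature_matrix_distinct[OF assms(3)] abs_if field_simps split: if_splits)
qed

text \<open>The two sides are the sets where \<open>e\<close> is 1 and -1: the product
  \<open>e i * e j\<close> is -1, meaning adjacency, exactly across the sides. A constant
  \<open>e\<close> gives an empty side and an edgeless graph.\<close>

lemma complete_bipartite_induced_frame_graph_iff:
  fixes F :: "'n::finite \<Rightarrow> real ^ 'k"
  assumes sign: "\<And>i j. i \<noteq> j \<Longrightarrow> signature_matrix F $ i $ j \<in> {1, -1}"
  shows "(\<exists>H. induced_subgraph H (frame_graph F) \<and> verts H = S \<and> complete_bipartite H) \<longleftrightarrow>
    (\<exists>e. (\<forall>i\<in>S. e i \<in> {1, -1::real}) \<and>
      (\<forall>i\<in>S. \<forall>j\<in>S. i \<noteq> j \<longrightarrow> signature_matrix F $ i $ j = e i * e j))" (is "?L \<longleftrightarrow> ?R")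
proof
  assume ?L
  then obtain H U V where H: "induced_subgraph H (frame_graph F)" "verts H = S"
    and UV: "S = U \<union> V" "U \<inter> V = {}" "arcs_ends H = U \<times> V \<union> V \<times> U"
    unfolding complete_bipartite_def complete_bipartite_digraph_def by metis
  \<comment> \<open>Inducedness matters here: \<open>H\<close> keeps every arc of the frame graph
    between vertices of \<open>S\<close>, so non-adjacency in \<open>H\<close> also determines the
    sign.\<close>
  have ends: "(i, j) \<in> arcs_ends H \<longleftrightarrow> signature_matrix F $ i $ j = -1"
    if "i \<in> S" "j \<in> S" "i \<noteq> j" for i j
    using H that by (auto simp: induced_subgraph_def subgraph_def compatible_def frame_graph_def
        arcs_ends_def arc_to_ends_def)
  have "signature_matrix F $ i $ j = (if i \<in> U then 1 else -1) * (if j \<in> U then 1 else -1)"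
    if "i \<in> S" "j \<in> S" "i \<noteq> j" for i j
  proof -
    have "signature_matrix F $ i $ j = -1 \<longleftrightarrow> (i \<in> U \<longleftrightarrow> j \<notin> U)"
      unfolding ends[OF that, symmetric] UV(3) using that(1,2) UV(1,2) by blast
    then show ?thesis using sign[OF that(3)] by auto
  qed
  then show ?R by (intro exI[of _ "\<lambda>i. if i \<in> U then 1 else -1"]) auto
next
  assume ?R
  then obtain e where e: "\<forall>i\<in>S. e i \<in> {1, -1::real}"
    and s: "\<forall>i\<in>S. \<forall>j\<in>S. i \<noteq> j \<longrightarrow> signature_matrix F $ i $ j = e i * e j"
    by (elim exE conjE)
  interpret G: graph "frame_graph F" by (rule graph_frame_graph)
  let ?H = "frame_graph F \<restriction> S"
  let ?U = "{i\<in>S. e i = 1}" and ?V = "{i\<in>S. e i = -1}"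
  have verts: "verts ?H = S" by simp
  have ind: "induced_subgraph ?H (frame_graph F)"
    by (rule G.induced_induce) (simp add: frame_graph_def)
  then have "graph ?H"
    using G.digraphI_induced G.induced_graph_imp_graph
    by (simp add: graph_def pseudo_graph_def digraph_def)
  moreover have "S = ?U \<union> ?V" using e by blast
  moreover have "?U \<inter> ?V = {}" by auto
  moreover have "arcs_ends ?H = ?U \<times> ?V \<union> ?V \<times> ?U"
  proof -
    have "(i, j) \<in> arcs_ends ?H \<longleftrightarrow> i \<in> S \<and> j \<in> S \<and> i \<noteq> j \<and> e i * e j = -1" for i j
      using s by (auto simp: frame_graph_def arcs_ends_def arc_to_ends_def)
    moreover have "i \<in> S \<and> j \<in> S \<and> i \<noteq> j \<and> e i * e j = -1 \<longleftrightarrow> (i, j) \<in> ?U \<times> ?V \<union> ?V \<times> ?U" for i j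
      using e by auto
    ultimately show ?thesis by auto
  qed
  ultimately have "complete_bipartite ?H"
    unfolding complete_bipartite_def complete_bipartite_digraph_def verts by blast
  with ind verts show ?L by blast
qed

theorem theorem5p3:
  fixes F :: "'n::finite \<Rightarrow> real ^ 'k" and m :: nat
  assumes "CARD('k) < CARD('n)"
    and "two_uniform_frame F"
    and "1 \<le> m" and "m \<le> CARD('n)"
  shows "max_erasure_error m F
           \<le> real CARD('k) / real CARD('n) + (real m - 1) * frame_const CARD('n) CARD('k) \<and>
         (max_erasure_error m F
            = real CARD('k) / real CARD('n) + (real m - 1) * frame_const CARD('n) CARD('k) \<longleftrightarrow>
          (\<exists>H. induced_subgraph H (frame_graph F) \<and> card (verts H) = m \<and> complete_bipartite H))"
proof -
  let ?a = "real CARD('k) / real CARD('n)" and ?c = "frame_const CARD('n) CARD('k)"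
  let ?s = "\<lambda>i j. signature_matrix F $ i $ j"
  let ?N = "\<lambda>S. onorm (partial_frame_operator F S)"
  let ?B = "?a + (real m - 1) * ?c"
  have c: "0 < ?c" using assms(1) by (intro frame_const_pos) auto
  have equiangular: "equiangular F S ?a ?c ?s" if "card S = m" for S
    using that assms c two_uniform_frame_signature[OF assms(1,2)]
    by unfold_locales (auto simp: two_uniform_frame_def uniform_frame_inner_same)
  have le: "?N S \<le> ?B" if "card S = m" for S
    using equiangular.onorm_le_bound[OF equiangular[OF that]]
    by (simp add: equiangular.bound_def[OF equiangular[OF that]] that)
  \<comment> \<open>The vertex set is fixed to \<open>S\<close> here; quantifying over all
    \<open>S\<close> of size \<open>m\<close> afterwards gives the condition on
    \<open>card (verts H)\<close>.\<close>
  have eq: "?N S = ?B \<longleftrightarrow>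
      (\<exists>H. induced_subgraph H (frame_graph F) \<and> verts H = S \<and> complete_bipartite H)"
    if "card S = m" for S
  proof -
    interpret equiangular F S ?a ?c ?s by (rule equiangular[OF that])
    have "?N S = bound \<longleftrightarrow> (\<exists>e. (\<forall>i\<in>S. e i \<in> {1, -1::real}) \<and>
        (\<forall>i\<in>S. \<forall>j\<in>S. i \<noteq> j \<longrightarrow> ?s i j = e i * e j))"
    proof
      assume "?N S = bound"
      from onorm_eq_boundD[OF this c] show "\<exists>e. (\<forall>i\<in>S. e i \<in> {1, -1::real}) \<and>
        (\<forall>i\<in>S. \<forall>j\<in>S. i \<noteq> j \<longrightarrow> ?s i j = e i * e j)"
        by (smt (verit))
    qed (elim exE conjE, rule onorm_eq_boundI, simp_all)
    also have "\<dots> \<longleftrightarrow>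
        (\<exists>H. induced_subgraph H (frame_graph F) \<and> verts H = S \<and> complete_bipartite H)"
      by (rule complete_bipartite_induced_frame_graph_iff[symmetric])
        (rule two_uniform_frame_signature(1)[OF assms(1,2)])
    finally show ?thesis by (simp only: bound_def that)
  qed
  let ?A = "?N ` {S. card S = m}"
  have max: "max_erasure_error m F = Max ?A"
    by (simp add: max_erasure_error_def erasure_error_image)
  have "finite ?A" by simp
  moreover have "?A \<noteq> {}" using obtain_subset_with_card_n[OF assms(4)] by auto
  \<comment> \<open>As \<open>?B\<close> bounds the finite set \<open>?A\<close>, the maximum equals
    \<open>?B\<close> exactly when some \<open>S\<close> attains it.\<close>
  ultimately have "Max ?A \<le> ?B" "Max ?A = ?B \<longleftrightarrow> ?B \<in> ?A"
    using le by (auto simp: Max_eq_iff)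
  moreover have "?B \<in> ?A \<longleftrightarrow> (\<exists>S. card S = m \<and> ?N S = ?B)"
    unfolding image_iff by (metis mem_Collect_eq)
  ultimately show ?thesis unfolding max using eq by metis
qed

end
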